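(* Let $\gamma:\mathbb{R}\times\mathbb{R}\to\mathbb{R}$ be a measurable function and let $M_\gamma$ be the associated oscillatory maximal function. Suppose that one of the following conditions holds: (1) $\gamma(x,t)=\alpha(x)\beta(t)$, where $\alpha,\beta:\mathbb{R}\to\mathbb{R}$ are measurable functions, $\alpha\in L^\infty(\mathbb{R})$, and $\beta$ is continuous; or (2) $\gamma(x,t)=\sum_{j=-d}^{d}c_j(x)t^j$ for real functions $c_j\in L^\infty(\mathbb{R})$, $-d\le j\le d$, with $d$ a positive integer. Then there exists $f\in H^1(\mathbb{R})$ such that $M_\gamma f\notin L^1(\mathbb{R})$.
   Context: For a measurable $\gamma:\mathbb{R}\times\mathbb{R}\to\mathbb{R}$ (in case (2), $\gamma(x,t)$ is defined by the formula for $t\neq 0$; its value at $t=0$ is irrelevant), the oscillatory maximal function is $$M_\gamma f(x)=\sup_{r>0}\frac{1}{2r}\left|\int_{-r}^{r}f(x-t)e^{i\gamma(x,t)}\,dt\right|.$$ $H^1(\mathbb{R})$ is the classical real Hardy space: the space of $f\in L^1(\mathbb{R})$ such that $M_\varphi f(x)=\sup_{t>0}|f*\varphi_t(x)|$ belongs to $L^1(\mathbb{R})$, where $\varphi$ is a fixed Schwartz function with $\int\varphi\neq0$ and $\varphi_t(y)=t^{-1}\varphi(y/t)$ (the space does not depend on the choice of $\varphi$). *)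

theory Defs
  imports "HOL-Analysis.Analysis"
begin

(* Measurability is Lebesgue (not merely Borel) measurability throughout, and elements of
   L^1 and L^infinity are represented by functions rather than by classes modulo null sets. *)

definition Linf :: "(real \<Rightarrow> real) \<Rightarrow> bool" where
  "Linf g \<longleftrightarrow> g \<in> borel_measurable lebesgue \<and> (\<exists>C. AE x in lebesgue. \<bar>g x\<bar> \<le> C)"

(* Membership in L^1 for [0,\<infinity>]-valued functions: maximal functions can be infinite at
   some points, so integrable, which needs values in a Banach space, does not apply to them. *)
definition L1_ennreal :: "(real \<Rightarrow> ennreal) \<Rightarrow> bool" where
  "L1_ennreal g \<longleftrightarrow> g \<in> borel_measurable lebesgue \<and> (\<integral>\<^sup>+ x. g x \<partial>lebesgue) < \<infinity>"

definition osc_maximal :: "(real \<Rightarrow> real \<Rightarrow> real) \<Rightarrow> (real \<Rightarrow> complex) \<Rightarrow> real \<Rightarrow> ennreal" where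
  "osc_maximal \<gamma> f x =
     (SUP r\<in>{0<..}. ennreal (1 / (2 * r) *
        cmod (LINT t:{-r..r}|lebesgue. f (x - t) * exp (\<i> * complex_of_real (\<gamma> x t)))))"

(* D n is the n-th derivative of \<phi>. *)
definition schwartz :: "(real \<Rightarrow> complex) \<Rightarrow> bool" where
  "schwartz \<phi> \<longleftrightarrow>
     (\<exists>D :: nat \<Rightarrow> real \<Rightarrow> complex. D 0 = \<phi> \<and>
        (\<forall>n x. (D n has_vector_derivative D (Suc n) x) (at x)) \<and>
        (\<forall>m n. bounded (range (\<lambda>x. x ^ m *\<^sub>R D n x))))"

definition dilate :: "(real \<Rightarrow> complex) \<Rightarrow> real \<Rightarrow> real \<Rightarrow> complex" where
  "dilate \<phi> t y = (1 / t) *\<^sub>R \<phi> (y / t)"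

definition convolve :: "(real \<Rightarrow> complex) \<Rightarrow> (real \<Rightarrow> complex) \<Rightarrow> real \<Rightarrow> complex" where
  "convolve f g x = (LINT y|lebesgue. f y * g (x - y))"

definition smooth_maximal :: "(real \<Rightarrow> complex) \<Rightarrow> (real \<Rightarrow> complex) \<Rightarrow> real \<Rightarrow> ennreal" where
  "smooth_maximal \<phi> f x = (SUP t\<in>{0<..}. ennreal (cmod (convolve f (dilate \<phi> t) x)))"

(* The real Hardy space, with the Schwartz function \<phi> of its definition as a parameter. *)
definition hardy_H1 :: "(real \<Rightarrow> complex) \<Rightarrow> (real \<Rightarrow> complex) set" where
  "hardy_H1 \<phi> = {f. integrable lebesgue f \<and> L1_ennreal (smooth_maximal \<phi> f)}"

end

theory Submission
  imports Defs "HOL-Probability.Sinc_Integral"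
begin

text \<open>
  The averages in the maximal function \<open>M\<^sub>\<gamma>\<close> have sharp cutoffs, and an average whose interval ends
  inside the support of \<open>f\<close> does not see the cancellation of \<open>f\<close>. Let the dipole \<open>a\<^sub>\<delta>\<close> be
  \<open>1 / \<delta>\<close> on \<open>(0, \<delta>]\<close> and \<open>- 1 / \<delta>\<close> on \<open>[-\<delta>, 0)\<close>. Up to a constant it is an atom of the Hardy
  space, so its smooth maximal function has an integral that is bounded independently of \<open>\<delta>\<close>.
  For \<open>x > \<delta>\<close> the interval of radius \<open>r = x\<close> around \<open>x\<close> has the left endpoint \<open>0\<close>, so the
  average sees only the positive half of \<open>a\<^sub>\<delta>\<close>. If the phase
  \<open>y \<mapsto> \<gamma>(x, x - y)\<close> is almost constant on \<open>[0, \<delta>]\<close>, the average has size about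
  \<open>1 / (2 x)\<close>, and integrating over the admissible \<open>x\<close> produces a logarithm.

  How far the phase stays almost constant is recorded by \<open>slow_phase D \<gamma>\<close>: for almost every small
  \<open>x > 0\<close> it moves by at most \<open>1 / 2\<close> on \<open>0 \<le> y \<le> x\<^sup>D\<close>. A product \<open>\<alpha>(x) \<beta>(t)\<close> satisfies this with
  \<open>D = 1\<close> because \<open>\<beta>\<close> is continuous at \<open>0\<close> (\<open>slow_phase_product\<close>). A Laurent polynomial of degree
  \<open>d\<close> in \<open>t\<close> has a derivative of size \<open>x\<close> to the power \<open>- d - 1\<close> near \<open>t = x\<close>, so \<open>D = d + 2\<close> works
  (\<open>slow_phase_laurent\<close>). The admissible \<open>x\<close> for one dipole are then those between the
  \<open>D\<close>-th root of \<open>\<delta>\<close> and a small constant, which still gives a multiple of \<open>ln (1 / \<delta>)\<close>.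

  A single function is obtained by superposition, \<open>f = \<Sum>\<^sub>k 2\<^sup>-\<^sup>k a\<close> with the dipole of scale
  \<open>\<delta>\<^sub>k\<close> in the \<open>k\<close>-th term; it lies in the Hardy space since the weights are summable
  (\<open>dipole_series_in_hardy_H1\<close>). Consider \<open>x\<close> between the \<open>D\<close>-th root of \<open>\<delta>\<^sub>k\<close> and a small
  multiple of \<open>2\<^sup>-\<^sup>k\<close> times the preceding scale. The \<open>k\<close>-th dipole contributes at least
  about \<open>2\<^sup>-\<^sup>k / x\<close>. The finer dipoles have the same sign on the positive half-line and see the
  same slow phase, so they can only help. The coarser ones, for which the phase is uncontrolled,
  are too spread out to matter (\<open>osc_maximal_lower_bound\<close>). When \<open>\<delta>\<^sub>k\<close> decreases
  superexponentially, the length of this interval on the logarithmic scale beats the factor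
  \<open>2\<^sup>-\<^sup>k\<close>, and the integral of \<open>M\<^sub>\<gamma> f\<close> exceeds every bound (\<open>slow_phase_not_L1\<close>).
\<close>

section \<open>The Poisson kernel and Schwartz functions\<close>

text \<open>
  The Poisson kernel of the upper half-plane without its factor \<open>1 / \<pi>\<close>. It serves twice: in \<open>z\<close>
  at height \<open>t\<close> it dominates the dilates of a Schwartz function, and at height \<open>\<delta>\<close> it is an
  integrable majorant of the smooth maximal function of the dipole of scale \<open>\<delta>\<close>.
\<close>
definition poisson_kernel :: "real \<Rightarrow> real \<Rightarrow> real" where
  "poisson_kernel t z = t / (t\<^sup>2 + z\<^sup>2)"

lemma poisson_kernel_nonneg: "0 \<le> t \<Longrightarrow> 0 \<le> poisson_kernel t z"
  by (simp add: poisson_kernel_def)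

lemma poisson_kernel_measurable [measurable]: "poisson_kernel t \<in> borel_measurable borel"
  unfolding poisson_kernel_def by measurable

lemma poisson_kernel_integral:
  assumes "t > 0"
  shows "integrable lborel (poisson_kernel t)" "(\<integral>z. poisson_kernel t z \<partial>lborel) = pi"
proof -
  have i: "integrable lborel (\<lambda>x::real. inverse (1 + x\<^sup>2))"
    using integrable_inverse_1_plus_square by (simp add: set_integrable_def einterval_def)
  have v: "(\<integral>x. inverse (1 + x\<^sup>2) \<partial>lborel) = pi"
    using LBINT_inverse_1_plus_square
    by (simp add: interval_lebesgue_integral_def set_lebesgue_integral_def einterval_def)
  have e: "poisson_kernel t (0 + t * x) = (1 / t) * inverse (1 + x\<^sup>2)" for x
  proof -
    have "1 + x * x \<noteq> 0" by (metis add_pos_nonneg less_irrefl zero_le_square zero_less_one)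
    then show ?thesis using assms unfolding poisson_kernel_def
      by (simp add: power2_eq_square divide_simps) (simp add: algebra_simps)
  qed
  show "integrable lborel (poisson_kernel t)"
    using lborel_integrable_real_affine_iff[of t "poisson_kernel t" 0] i assms
    unfolding e by simp
  show "(\<integral>z. poisson_kernel t z \<partial>lborel) = pi"
    using lborel_integral_real_affine[of t "poisson_kernel t" 0] v assms
    unfolding e by simp
qed

lemma poisson_kernel_reflect_integral:
  assumes "t > 0"
  shows "integrable lborel (\<lambda>y. poisson_kernel t (x - y))"
    "(\<integral>y. poisson_kernel t (x - y) \<partial>lborel) = pi"
  using lborel_integrable_real_affine_iff[of "-1" "poisson_kernel t" x]
    lborel_integral_real_affine[of "-1" "poisson_kernel t" x] poisson_kernel_integral[OF assms]
  by simp_all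

text \<open>
  The function is bounded by a multiple of \<open>poisson_kernel 1\<close>, and its derivative by a multiple of
  \<open>1 / z\<^sup>2\<close>; the latter weight is homogeneous, which makes the bounds on the dilates uniform in the
  dilation parameter.
\<close>
lemma schwartz_bounds:
  assumes "schwartz \<phi>"
  obtains C \<phi>' where "C > 0" "\<And>x. (\<phi> has_vector_derivative \<phi>' x) (at x)"
    "\<And>z. cmod (\<phi> z) \<le> C / (1 + z\<^sup>2)" "\<And>z. z\<^sup>2 * cmod (\<phi>' z) \<le> C"
proof -
  from assms obtain D where D: "D 0 = \<phi>"
    "\<And>n x. (D n has_vector_derivative D (Suc n) x) (at x)"
    "\<And>m n. bounded (range (\<lambda>x. x ^ m *\<^sub>R D n x))"
    unfolding schwartz_def by blast
  obtain A where A: "\<And>x. norm (x ^ 0 *\<^sub>R D 0 x) \<le> A"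
    using D(3)[of 0 0] unfolding bounded_iff by blast
  obtain B where B: "\<And>x. norm (x ^ 2 *\<^sub>R D 0 x) \<le> B"
    using D(3)[of 2 0] unfolding bounded_iff by blast
  obtain E where E: "\<And>x. norm (x ^ 2 *\<^sub>R D 1 x) \<le> E"
    using D(3)[of 2 1] unfolding bounded_iff by blast
  have nn: "0 \<le> A" "0 \<le> B" "0 \<le> E"
    using A[of 0] B[of 0] E[of 0] norm_ge_zero order_trans by blast+
  show thesis
  proof
    show "A + B + E + 1 > 0" using nn by simp
    show "(\<phi> has_vector_derivative D 1 x) (at x)" for x
      using D(2)[of 0 x] D(1) by simp
    show "cmod (\<phi> z) \<le> (A + B + E + 1) / (1 + z\<^sup>2)" for z
    proof -
      have "cmod (\<phi> z) * (1 + z\<^sup>2) \<le> A + B"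
        using A[of z] B[of z] D(1) by (simp add: algebra_simps)
      then have "cmod (\<phi> z) * (1 + z\<^sup>2) \<le> A + B + E + 1" using nn by linarith
      moreover have "0 < 1 + z\<^sup>2" by (simp add: add_pos_nonneg)
      ultimately show ?thesis by (simp add: pos_le_divide_eq)
    qed
    show "z\<^sup>2 * cmod (D 1 z) \<le> A + B + E + 1" for z
      using E[of z] nn by simp
  qed
qed

text \<open>
  The two regimes of the atomic estimate below, the decay \<open>\<delta> / x\<^sup>2\<close> far from the dipole and the height
  \<open>1 / \<delta>\<close> near it, have a common majorant.
\<close>
lemma poisson_far:
  assumes "\<delta> > 0" "\<bar>x\<bar> \<ge> 2 * \<delta>"
  shows "\<delta> / x\<^sup>2 \<le> 5 * poisson_kernel \<delta> x"
proof -
  have "(2 * \<delta>)\<^sup>2 \<le> x\<^sup>2" using assms by (metis abs_le_square_iff abs_of_pos mult_pos_pos zero_less_numeral)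
  then have "4 * \<delta>\<^sup>2 \<le> x\<^sup>2" by (simp add: power_mult_distrib)
  moreover have "0 < \<delta>\<^sup>2" using assms by simp
  ultimately have "\<delta>\<^sup>2 + x\<^sup>2 \<le> 5 * x\<^sup>2" "x\<^sup>2 > 0" "\<delta>\<^sup>2 + x\<^sup>2 > 0" by linarith+
  then show ?thesis unfolding poisson_kernel_def
    using assms(1) by (simp add: field_simps)
qed

lemma poisson_near:
  assumes "\<delta> > 0" "\<bar>x\<bar> \<le> 2 * \<delta>"
  shows "1 / \<delta> \<le> 5 * poisson_kernel \<delta> x"
proof -
  have "x\<^sup>2 \<le> (2 * \<delta>)\<^sup>2" using assms by (metis abs_le_square_iff abs_of_pos mult_pos_pos zero_less_numeral)
  then have "\<delta>\<^sup>2 + x\<^sup>2 \<le> 5 * \<delta>\<^sup>2" "\<delta>\<^sup>2 + x\<^sup>2 > 0" using assms by (auto simp: power_mult_distrib intro: add_pos_nonneg)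
  then show ?thesis unfolding poisson_kernel_def
    using assms(1) by (simp add: field_simps power2_eq_square)
qed

lemma dilate_le_poisson:
  assumes "t > 0" "\<And>z. cmod (\<phi> z) \<le> C / (1 + z\<^sup>2)"
  shows "cmod (dilate \<phi> t z) \<le> C * poisson_kernel t z"
proof -
  have "cmod (dilate \<phi> t z) = (1 / t) * cmod (\<phi> (z / t))"
    using assms(1) by (simp add: dilate_def norm_divide)
  also have "\<dots> \<le> (1 / t) * (C / (1 + (z / t)\<^sup>2))"
    using assms by (intro mult_left_mono) auto
  also have "\<dots> = C * poisson_kernel t z"
    using assms(1) unfolding poisson_kernel_def by (simp add: power2_eq_square divide_simps add_nonneg_eq_0_iff)
  finally show ?thesis .
qed

text \<open>
  On the segment from \<open>x - y\<close> to \<open>x\<close> all points have modulus at least \<open>\<bar>x\<bar> / 2\<close>, where the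
  derivative of the dilate is at most a multiple of \<open>1 / x\<^sup>2\<close>: the two powers of \<open>t\<close> that
  differentiation and dilation cost are the ones that the decay of \<open>\<phi>'\<close> returns. Thus the
  bound is uniform in \<open>t\<close>.
\<close>
lemma dilate_increment:
  assumes "t > 0" "x \<noteq> 0" "\<bar>y\<bar> \<le> \<bar>x\<bar> / 2"
    and der: "\<And>x. (\<phi> has_vector_derivative \<phi>' x) (at x)"
    and C: "\<And>z. z\<^sup>2 * cmod (\<phi>' z) \<le> C"
  shows "cmod (dilate \<phi> t (x - y) - dilate \<phi> t x) \<le> 4 * C * \<bar>y\<bar> / x\<^sup>2"
proof -
  define B where "B = 4 * C * t\<^sup>2 / x\<^sup>2"
  have d: "cmod (\<phi>' z) \<le> B" if z: "\<bar>z\<bar> \<ge> \<bar>x\<bar> / (2 * t)" for z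
  proof -
    have "(x / (2 * t))\<^sup>2 \<le> z\<^sup>2" using z assms(1) by (intro abs_le_square_iff[THEN iffD1]) (simp add: abs_divide)
    then have "(x / (2 * t))\<^sup>2 * cmod (\<phi>' z) \<le> z\<^sup>2 * cmod (\<phi>' z)" by (rule mult_right_mono) simp
    also have "\<dots> \<le> C" by (rule C)
    finally show ?thesis unfolding B_def using assms(1,2)
      by (simp add: power_divide power_mult_distrib field_simps)
  qed
  have seg: "\<bar>z\<bar> \<ge> \<bar>x\<bar> / (2 * t)" if z: "z \<in> closed_segment (x / t) ((x - y) / t)" for z
  proof -
    have "\<bar>z - x / t\<bar> \<le> \<bar>(x - y) / t - x / t\<bar>"
      using segment_bound1[OF z] by simp
    also have "\<dots> = \<bar>y\<bar> / t" using assms(1) by (simp add: diff_divide_distrib)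
    also have "\<dots> \<le> \<bar>x\<bar> / (2 * t)" using assms(1,3) by (simp add: field_simps)
    finally have "\<bar>z - x / t\<bar> \<le> \<bar>x\<bar> / (2 * t)" .
    moreover have "\<bar>x / t\<bar> = 2 * (\<bar>x\<bar> / (2 * t))" using assms(1) by (simp add: abs_divide)
    ultimately show ?thesis by linarith
  qed
  have "norm (\<phi> ((x - y) / t) - \<phi> (x / t)) \<le> B * norm ((x - y) / t - x / t)"
  proof (rule differentiable_bound[where S = "closed_segment (x / t) ((x - y) / t)"
        and f = \<phi> and f' = "\<lambda>z s. s *\<^sub>R \<phi>' z"])
    fix z assume z: "z \<in> closed_segment (x / t) ((x - y) / t)"
    show "(\<phi> has_derivative (\<lambda>s. s *\<^sub>R \<phi>' z)) (at z within closed_segment (x / t) ((x - y) / t))"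
      using der[of z] unfolding has_vector_derivative_def by (rule has_derivative_at_withinI)
    show "onorm (\<lambda>s. s *\<^sub>R \<phi>' z) \<le> B"
      using d[OF seg[OF z]] by (intro onorm_le) (metis mult.commute mult_right_mono norm_ge_zero norm_scaleR real_norm_def)
  qed auto
  also have "\<dots> = B * (\<bar>y\<bar> / t)" using assms(1) by (simp add: diff_divide_distrib)
  finally have *: "norm (\<phi> ((x - y) / t) - \<phi> (x / t)) \<le> B * (\<bar>y\<bar> / t)" .
  have "cmod (dilate \<phi> t (x - y) - dilate \<phi> t x) = (1 / t) * norm (\<phi> ((x - y) / t) - \<phi> (x / t))"
    using assms(1) by (simp add: dilate_def scaleR_diff_right[symmetric] del: scaleR_diff_right)
  also have "\<dots> \<le> (1 / t) * (B * (\<bar>y\<bar> / t))" using assms(1) * by (intro mult_left_mono) auto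
  also have "\<dots> = 4 * C * \<bar>y\<bar> / x\<^sup>2" unfolding B_def using assms(1) by (simp add: power2_eq_square)
  finally show ?thesis .
qed

section \<open>Dipoles and their smooth maximal functions\<close>

definition dipole :: "real \<Rightarrow> real \<Rightarrow> real" where
  "dipole \<delta> y = (indicator {0<..\<delta>} y - indicator {-\<delta>..<0} y) / \<delta>"

lemma dipole_measurable [measurable]: "dipole \<delta> \<in> borel_measurable borel"
  unfolding dipole_def by measurable

lemma dipole_integral:
  assumes "\<delta> > 0"
  shows "integrable lborel (dipole \<delta>)" "(\<integral>y. dipole \<delta> y \<partial>lborel) = 0"
    "(\<integral>y. \<bar>dipole \<delta> y\<bar> \<partial>lborel) = 2"
proof -
  have a: "\<bar>dipole \<delta> y\<bar> = (indicator {0<..\<delta>} y + indicator {-\<delta>..<0} y) / \<delta>" for y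
    using assms by (auto simp: dipole_def indicator_def)
  show "integrable lborel (dipole \<delta>)" "(\<integral>y. dipole \<delta> y \<partial>lborel) = 0"
    unfolding dipole_def using assms by (auto simp: integrable_indicator_iff)
  show "(\<integral>y. \<bar>dipole \<delta> y\<bar> \<partial>lborel) = 2"
    unfolding a using assms by simp
qed

lemma dipole_support: "\<bar>y\<bar> > \<delta> \<Longrightarrow> dipole \<delta> y = 0"
  by (auto simp: dipole_def indicator_def)

lemma dipole_bound: "\<delta> > 0 \<Longrightarrow> \<bar>dipole \<delta> y\<bar> \<le> 1 / \<delta>"
  by (auto simp: dipole_def indicator_def)

text \<open>
  The atomic estimate, uniform in \<open>t\<close> and with the right dependence on \<open>\<delta>\<close>. At distance
  at most \<open>2 \<delta>\<close> from the origin the height \<open>1 / \<delta>\<close> of the dipole times the \<open>L\<^sup>1\<close> norm of the dilate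
  suffices. Farther away, the vanishing mean of the dipole allows the subtraction of
  \<open>dilate \<phi> t x\<close>, which gains the factor \<open>\<delta> / \<bar>x\<bar>\<close>.
\<close>
lemma dipole_convolution_bound:
  assumes "t > 0" "\<delta> > 0" "C > 0"
    and der: "\<And>x. (\<phi> has_vector_derivative \<phi>' x) (at x)"
    and C0: "\<And>z. cmod (\<phi> z) \<le> C / (1 + z\<^sup>2)"
    and C1: "\<And>z. z\<^sup>2 * cmod (\<phi>' z) \<le> C"
    and [measurable]: "\<phi> \<in> borel_measurable borel"
  shows "cmod (\<integral>y. complex_of_real (dipole \<delta> y) * dilate \<phi> t (x - y) \<partial>lborel)
           \<le> 40 * C * poisson_kernel \<delta> x"
proof -
  have [measurable]: "dilate \<phi> t \<in> borel_measurable borel" unfolding dilate_def by measurable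
  have gbound: "cmod (dilate \<phi> t z) \<le> C * poisson_kernel t z" for z
    using dilate_le_poisson[OF assms(1) C0] .
  have int: "integrable lborel (\<lambda>y. complex_of_real (dipole \<delta> y) * dilate \<phi> t (x - y))"
  proof (rule Bochner_Integration.integrable_bound)
    show "integrable lborel (\<lambda>y. (1 / \<delta>) * (C * poisson_kernel t (x - y)))"
      using poisson_kernel_reflect_integral(1)[OF assms(1)] by auto
    show "AE y in lborel. norm (complex_of_real (dipole \<delta> y) * dilate \<phi> t (x - y))
        \<le> norm ((1 / \<delta>) * (C * poisson_kernel t (x - y)))"
      using dipole_bound[OF assms(2)] gbound assms
      by (auto simp: norm_mult poisson_kernel_nonneg intro!: mult_mono simp del: times_divide_eq_left)
  qed measurable
  show ?thesis
  proof (cases "\<bar>x\<bar> \<le> 2 * \<delta>")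
    case True
    have "cmod (\<integral>y. complex_of_real (dipole \<delta> y) * dilate \<phi> t (x - y) \<partial>lborel)
        \<le> (\<integral>y. (1 / \<delta>) * (C * poisson_kernel t (x - y)) \<partial>lborel)"
      using dipole_bound[OF assms(2)] gbound assms poisson_kernel_reflect_integral(1)[OF assms(1)]
      by (intro Bochner_Integration.integral_norm_bound_integral int)
        (auto simp: norm_mult intro!: mult_mono simp del: times_divide_eq_left)
    also have "\<dots> = C * pi * (1 / \<delta>)" using poisson_kernel_reflect_integral(2)[OF assms(1)] by simp
    also have "\<dots> \<le> C * pi * (5 * poisson_kernel \<delta> x)"
      using poisson_near[OF assms(2) True] assms by (intro mult_left_mono) auto
    also have "\<dots> = (5 * pi) * (C * poisson_kernel \<delta> x)" by simp
    also have "\<dots> \<le> 40 * (C * poisson_kernel \<delta> x)"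
      using pi_less_4 assms by (intro mult_right_mono) (auto simp: poisson_kernel_nonneg)
    finally show ?thesis by simp
  next
    case False
    then have x: "x \<noteq> 0" using assms by auto
    have "(\<integral>y. complex_of_real (dipole \<delta> y) * dilate \<phi> t (x - y) \<partial>lborel)
       = (\<integral>y. complex_of_real (dipole \<delta> y) * dilate \<phi> t (x - y) \<partial>lborel)
         - (\<integral>y. complex_of_real (dipole \<delta> y) * dilate \<phi> t x \<partial>lborel)"
      using dipole_integral[OF assms(2)] by simp
    also have "\<dots> = (\<integral>y. complex_of_real (dipole \<delta> y) * (dilate \<phi> t (x - y) - dilate \<phi> t x) \<partial>lborel)"
      using int dipole_integral[OF assms(2)]
      by (subst Bochner_Integration.integral_diff[symmetric]) (auto simp: right_diff_distrib)
    also have "cmod \<dots> \<le> (\<integral>y. \<bar>dipole \<delta> y\<bar> * (4 * C * \<delta> / x\<^sup>2) \<partial>lborel)"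
    proof (rule Bochner_Integration.integral_norm_bound_integral)
      show "integrable lborel (\<lambda>y. complex_of_real (dipole \<delta> y) * (dilate \<phi> t (x - y) - dilate \<phi> t x))"
        using int dipole_integral[OF assms(2)] by (auto simp: right_diff_distrib)
      show "integrable lborel (\<lambda>y. \<bar>dipole \<delta> y\<bar> * (4 * C * \<delta> / x\<^sup>2))"
        using dipole_integral(1)[OF assms(2)] by auto
      fix y
      show "cmod (complex_of_real (dipole \<delta> y) * (dilate \<phi> t (x - y) - dilate \<phi> t x))
          \<le> \<bar>dipole \<delta> y\<bar> * (4 * C * \<delta> / x\<^sup>2)"
      proof (cases "\<bar>y\<bar> > \<delta>")
        case True
        then show ?thesis by (simp add: dipole_support)
      next
        case y: False
        have "cmod (dilate \<phi> t (x - y) - dilate \<phi> t x) \<le> 4 * C * \<bar>y\<bar> / x\<^sup>2"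
          using y False by (intro dilate_increment[OF assms(1) x _ der C1]) auto
        also have "\<dots> \<le> 4 * C * \<delta> / x\<^sup>2"
          using y assms(3) by (intro divide_right_mono mult_left_mono) auto
        finally show ?thesis unfolding norm_mult norm_of_real by (rule mult_left_mono) simp
      qed
    qed
    also have "\<dots> = 8 * C * (\<delta> / x\<^sup>2)" using dipole_integral(3)[OF assms(2)] by simp
    also have "\<dots> \<le> 8 * C * (5 * poisson_kernel \<delta> x)"
      using poisson_far[OF assms(2)] False assms(3) by (intro mult_left_mono) auto
    finally show ?thesis by simp
  qed
qed

section \<open>Superpositions of dipoles belong to the Hardy space\<close>

text \<open>
  The convolutions are continuous by dominated convergence, so their supremum, although taken over an
  uncountable set, is lower semicontinuous.
\<close>
lemma smooth_maximal_measurable: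
  assumes f: "integrable lebesgue f"
    and cont: "continuous_on UNIV \<phi>" and bd: "\<And>z. cmod (\<phi> z) \<le> C"
  shows "smooth_maximal \<phi> f \<in> borel_measurable lebesgue"
proof -
  have [measurable]: "\<phi> \<in> borel_measurable borel"
    using cont by (rule borel_measurable_continuous_onI)
  have conv: "continuous_on UNIV (\<lambda>x. convolve f (dilate \<phi> t) x)" if t: "t > 0" for t
  proof -
    have "continuous (at x) (\<lambda>x. convolve f (dilate \<phi> t) x)" for x
      unfolding continuous_at_sequentially comp_def convolve_def
    proof (intro allI impI)
      fix X assume X: "X \<longlonglongrightarrow> x"
      have m: "(\<lambda>y. dilate \<phi> t (z - y)) \<in> borel_measurable lebesgue" for z
        unfolding dilate_def by (rule measurable_completion) measurable
      show "(\<lambda>n. LINT y|lebesgue. f y * dilate \<phi> t (X n - y))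
          \<longlonglongrightarrow> (LINT y|lebesgue. f y * dilate \<phi> t (x - y))"
      proof (rule integral_dominated_convergence)
        show "integrable lebesgue (\<lambda>y. cmod (f y) * (C / t))" using f by auto
        show "(\<lambda>y. f y * dilate \<phi> t (x - y)) \<in> borel_measurable lebesgue"
          using f m by (intro borel_measurable_times) auto
        show "(\<lambda>y. f y * dilate \<phi> t (X n - y)) \<in> borel_measurable lebesgue" for n
          using f m by (intro borel_measurable_times) auto
        have "isCont \<phi> z" for z using cont by (simp add: continuous_on_eq_continuous_at)
        then have "(\<lambda>n. f y * dilate \<phi> t (X n - y)) \<longlonglongrightarrow> f y * dilate \<phi> t (x - y)" for y
          unfolding dilate_def using t X
          by (intro tendsto_intros isCont_tendsto_compose[of _ \<phi>]) auto
        then show "AE y in lebesgue. (\<lambda>n. f y * dilate \<phi> t (X n - y)) \<longlonglongrightarrow> f y * dilate \<phi> t (x - y)"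
          by simp
        have "cmod (dilate \<phi> t z) \<le> C / t" for z
          using t bd[of "z / t"] by (simp add: dilate_def divide_right_mono norm_divide)
        then show "AE y in lebesgue. cmod (f y * dilate \<phi> t (X n - y)) \<le> cmod (f y) * (C / t)" for n
          unfolding norm_mult by (intro AE_I2 mult_left_mono) auto
      qed
    qed
    then show ?thesis by (simp add: continuous_at_imp_continuous_on)
  qed
  have "{x. a < smooth_maximal \<phi> f x} \<in> sets borel" for a
  proof -
    have "{x. a < smooth_maximal \<phi> f x}
        = (\<Union>t\<in>{0<..}. {x. a < ennreal (cmod (convolve f (dilate \<phi> t) x))})"
      by (auto simp: smooth_maximal_def less_SUP_iff)
    moreover have "open {x. a < ennreal (cmod (convolve f (dilate \<phi> t) x))}" if "t > 0" for t
      using conv[OF that] by (intro open_Collect_less continuous_intros continuous_on_ennreal) auto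
    ultimately show ?thesis by (simp add: open_UN)
  qed
  then have "smooth_maximal \<phi> f \<in> borel_measurable lborel"
    by (intro borel_measurableI_greater) simp
  then show ?thesis by (rule measurable_completion)
qed

definition dipole_series :: "(nat \<Rightarrow> real) \<Rightarrow> (nat \<Rightarrow> real) \<Rightarrow> real \<Rightarrow> real" where
  "dipole_series w \<delta> y = (\<Sum>j. w j * dipole (\<delta> j) y)"

lemma dipole_series_measurable [measurable]: "dipole_series w \<delta> \<in> borel_measurable borel"
  unfolding dipole_series_def by measurable

text \<open>
  At each point, the origin included, only finitely many dipoles are nonzero, so the series
  converges everywhere and not just almost everywhere.
\<close>
lemma dipole_vanishes_eventually:
  assumes "\<delta> \<longlonglongrightarrow> 0"
  shows "eventually (\<lambda>j. dipole (\<delta> j) y = 0) sequentially"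
proof (cases "y = 0")
  case True
  then show ?thesis by (simp add: dipole_def)
next
  case False
  then have "eventually (\<lambda>j. \<delta> j < \<bar>y\<bar>) sequentially"
    using order_tendstoD(2)[OF assms, of "\<bar>y\<bar>"] by simp
  then show ?thesis by eventually_elim (rule dipole_support)
qed

lemma dipole_series_summable:
  assumes "\<delta> \<longlonglongrightarrow> 0"
  shows "summable (\<lambda>j. norm (w j * dipole (\<delta> j) y))"
proof -
  have "eventually (\<lambda>j. norm (w j * dipole (\<delta> j) y) = 0) sequentially"
    using dipole_vanishes_eventually[OF assms, of y] by eventually_elim simp
  from summable_cong[OF this] show ?thesis by simp
qed

text \<open>
  Integration term by term against a bounded function; it is justified because every dipole has the
  same \<open>L\<^sup>1\<close> norm \<open>2\<close> and the weights are summable.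
\<close>
lemma dipole_series_integral:
  fixes g :: "real \<Rightarrow> complex"
  assumes \<delta>: "\<delta> \<longlonglongrightarrow> 0" "\<And>j. \<delta> j > 0" and w: "\<And>j. w j \<ge> 0" "summable w"
    and g: "g \<in> borel_measurable borel" "\<And>y. cmod (g y) \<le> B"
  shows "summable (\<lambda>j. norm (w j *\<^sub>R (\<integral>y. complex_of_real (dipole (\<delta> j) y) * g y \<partial>lborel)))"
    and "integrable lborel (\<lambda>y. complex_of_real (dipole_series w \<delta> y) * g y)"
    and "(\<integral>y. complex_of_real (dipole_series w \<delta> y) * g y \<partial>lborel)
      = (\<Sum>j. w j *\<^sub>R (\<integral>y. complex_of_real (dipole (\<delta> j) y) * g y \<partial>lborel))"
proof -
  note [measurable] = g(1)
  have B: "0 \<le> B" using g(2)[of 0] norm_ge_zero order_trans by blast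
  define h where "h j y = w j *\<^sub>R (complex_of_real (dipole (\<delta> j) y) * g y)" for j y
  have hb: "norm (h j y) \<le> w j * B * \<bar>dipole (\<delta> j) y\<bar>" for j y
  proof -
    have "norm (h j y) = w j * \<bar>dipole (\<delta> j) y\<bar> * cmod (g y)"
      using w(1) by (simp add: h_def norm_mult)
    also have "\<dots> \<le> w j * \<bar>dipole (\<delta> j) y\<bar> * B" using g(2) w(1) by (intro mult_left_mono) auto
    finally show ?thesis by (simp add: mult_ac)
  qed
  have majorant: "integrable lborel (\<lambda>y. w j * B * \<bar>dipole (\<delta> j) y\<bar>)" for j
    using dipole_integral(1)[OF \<delta>(2)] by auto
  have hi: "integrable lborel (h j)" for j
  proof (rule Bochner_Integration.integrable_bound[OF majorant[of j]])
    show "h j \<in> borel_measurable lborel" unfolding h_def by measurable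
    show "AE y in lborel. norm (h j y) \<le> norm (w j * B * \<bar>dipole (\<delta> j) y\<bar>)"
      using hb w(1) B by (auto simp: abs_mult)
  qed
  have nb: "(\<integral>y. norm (h j y) \<partial>lborel) \<le> 2 * B * w j" for j
  proof -
    have "(\<integral>y. norm (h j y) \<partial>lborel) \<le> (\<integral>y. w j * B * \<bar>dipole (\<delta> j) y\<bar> \<partial>lborel)"
      using hi hb majorant by (intro integral_mono) auto
    then show ?thesis using dipole_integral(3)[OF \<delta>(2)[of j]] by (simp add: mult_ac)
  qed
  have sn: "summable (\<lambda>j. \<integral>y. norm (h j y) \<partial>lborel)"
    by (rule summable_comparison_test'[where g = "\<lambda>j. 2 * B * w j" and N = 0])
      (use nb w in \<open>auto intro: summable_mult\<close>)
  have sp: "summable (\<lambda>j. norm (h j y))" for y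
  proof -
    have "norm (h j y) = norm (w j * dipole (\<delta> j) y) * cmod (g y)" for j
      by (simp add: h_def norm_mult abs_mult)
    then show ?thesis
      using summable_mult2[OF dipole_series_summable[OF \<delta>(1)]] by presburger
  qed
  have eq: "(\<Sum>j. h j y) = complex_of_real (dipole_series w \<delta> y) * g y" for y
  proof -
    have s: "summable (\<lambda>j. w j * dipole (\<delta> j) y)"
      using dipole_series_summable[OF \<delta>(1)] by (rule summable_norm_cancel)
    have "complex_of_real (dipole_series w \<delta> y) = (\<Sum>j. complex_of_real (w j * dipole (\<delta> j) y))"
      unfolding dipole_series_def by (rule suminf_of_real[OF s])
    then show ?thesis
      using suminf_mult2[OF summable_of_real[OF s, where 'a = complex], of "g y"]
      by (simp add: h_def scaleR_conv_of_real mult_ac)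
  qed
  have hint: "(\<integral>y. h j y \<partial>lborel) = w j *\<^sub>R (\<integral>y. complex_of_real (dipole (\<delta> j) y) * g y \<partial>lborel)" for j
    by (simp add: h_def)
  show "integrable lborel (\<lambda>y. complex_of_real (dipole_series w \<delta> y) * g y)"
    using integrable_suminf[of lborel h] hi sp sn by (simp add: eq)
  show "(\<integral>y. complex_of_real (dipole_series w \<delta> y) * g y \<partial>lborel)
      = (\<Sum>j. w j *\<^sub>R (\<integral>y. complex_of_real (dipole (\<delta> j) y) * g y \<partial>lborel))"
    using integral_suminf[of lborel h] hi sp sn by (simp only: eq hint) auto
  show "summable (\<lambda>j. norm (w j *\<^sub>R (\<integral>y. complex_of_real (dipole (\<delta> j) y) * g y \<partial>lborel)))"
    unfolding hint[symmetric]
    by (rule summable_comparison_test'[OF sn, where N = 0]) (simp add: hi integral_norm_bound)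
qed

text \<open>
  The majorants \<open>poisson_kernel (\<delta> j)\<close> all have the integral \<open>\<pi>\<close>, so the smooth maximal function
  of the superposition has an integral of at most a constant times the sum of the weights.
\<close>
lemma dipole_series_in_hardy_H1:
  assumes \<phi>: "schwartz \<phi>"
    and \<delta>: "\<delta> \<longlonglongrightarrow> 0" "\<And>j. \<delta> j > 0" and w: "\<And>j. w j \<ge> 0" "summable w"
  shows "(\<lambda>y. complex_of_real (dipole_series w \<delta> y)) \<in> hardy_H1 \<phi>"
proof -
  obtain C \<phi>' where C: "C > 0" "\<And>x. (\<phi> has_vector_derivative \<phi>' x) (at x)"
    "\<And>z. cmod (\<phi> z) \<le> C / (1 + z\<^sup>2)" "\<And>z. z\<^sup>2 * cmod (\<phi>' z) \<le> C"
    using schwartz_bounds[OF \<phi>] by blast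
  have cont: "continuous_on UNIV \<phi>"
    using C(2) has_vector_derivative_continuous continuous_at_imp_continuous_on by blast
  then have meas [measurable]: "\<phi> \<in> borel_measurable borel" by (rule borel_measurable_continuous_onI)
  have bd: "cmod (\<phi> z) \<le> C" for z
  proof -
    have "C / (1 + z\<^sup>2) \<le> C / 1" using C(1) by (intro divide_left_mono) (auto simp: add_pos_nonneg)
    then show ?thesis using C(3)[of z] by simp
  qed
  let ?f = "\<lambda>y. complex_of_real (dipole_series w \<delta> y)"
  have "integrable lborel ?f"
    using dipole_series_integral(2)[OF \<delta> w, of "\<lambda>_. 1" 1] by simp
  then have f: "integrable lebesgue ?f" by (simp add: integrable_completion)
  have bound: "smooth_maximal \<phi> ?f x \<le> (\<Sum>j. ennreal (w j * (40 * C * poisson_kernel (\<delta> j) x)))" for x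
    unfolding smooth_maximal_def
  proof (rule SUP_least)
    fix t :: real assume "t \<in> {0<..}"
    then have t: "t > 0" by simp
    have dm: "(\<lambda>y. dilate \<phi> t (x - y)) \<in> borel_measurable borel"
      unfolding dilate_def by measurable
    have db: "cmod (dilate \<phi> t (x - y)) \<le> C / t" for y
      using t bd[of "(x - y) / t"] by (simp add: dilate_def divide_right_mono norm_divide)
    note S = dipole_series_integral[OF \<delta> w dm db]
    let ?c = "\<lambda>j. \<integral>y. complex_of_real (dipole (\<delta> j) y) * dilate \<phi> t (x - y) \<partial>lborel"
    have "convolve ?f (dilate \<phi> t) x = (\<Sum>j. w j *\<^sub>R ?c j)"
      unfolding convolve_def S(3)[symmetric] using dm by (intro integral_completion) measurable
    then have "ennreal (cmod (convolve ?f (dilate \<phi> t) x)) \<le> ennreal (\<Sum>j. norm (w j *\<^sub>R ?c j))"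
      using summable_norm[OF S(1)] by (simp add: ennreal_leI)
    also have "\<dots> = (\<Sum>j. ennreal (norm (w j *\<^sub>R ?c j)))"
      using S(1) by (intro suminf_ennreal2[symmetric]) auto
    also have "\<dots> \<le> (\<Sum>j. ennreal (w j * (40 * C * poisson_kernel (\<delta> j) x)))"
      using dipole_convolution_bound[OF t \<delta>(2) C meas] w(1)
      by (intro suminf_le) (auto intro!: ennreal_leI mult_left_mono)
    finally show "ennreal (cmod (convolve ?f (dilate \<phi> t) x))
        \<le> (\<Sum>j. ennreal (w j * (40 * C * poisson_kernel (\<delta> j) x)))" .
  qed
  have "(\<integral>\<^sup>+ x. smooth_maximal \<phi> ?f x \<partial>lebesgue)
      \<le> (\<integral>\<^sup>+ x. (\<Sum>j. ennreal (w j * (40 * C * poisson_kernel (\<delta> j) x))) \<partial>lborel)"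
    unfolding nn_integral_completion by (intro nn_integral_mono bound)
  also have "\<dots> = (\<Sum>j. \<integral>\<^sup>+ x. ennreal (w j * (40 * C * poisson_kernel (\<delta> j) x)) \<partial>lborel)"
    by (rule nn_integral_suminf) measurable
  also have "\<dots> = (\<Sum>j. ennreal (40 * C * pi * w j))"
  proof (intro suminf_cong)
    fix j
    have "(\<integral>\<^sup>+ x. ennreal (w j * (40 * C * poisson_kernel (\<delta> j) x)) \<partial>lborel)
        = ennreal (\<integral>x. w j * (40 * C * poisson_kernel (\<delta> j) x) \<partial>lborel)"
      using poisson_kernel_integral(1)[OF \<delta>(2), of j] w(1) C(1) \<delta>(2)[of j]
      by (intro nn_integral_eq_integral) (auto simp: poisson_kernel_nonneg)
    then show "(\<integral>\<^sup>+ x. ennreal (w j * (40 * C * poisson_kernel (\<delta> j) x)) \<partial>lborel)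
        = ennreal (40 * C * pi * w j)"
      using poisson_kernel_integral(2)[OF \<delta>(2), of j] by (simp add: mult_ac)
  qed
  also have "\<dots> = ennreal (\<Sum>j. 40 * C * pi * w j)"
    using w C(1) by (intro suminf_ennreal2 summable_mult) auto
  also have "\<dots> < \<infinity>" by simp
  finally show ?thesis
    using f smooth_maximal_measurable[OF f cont bd]
    unfolding hardy_H1_def L1_ennreal_def by simp
qed

section \<open>Slowly varying phases\<close>

text \<open>
  The distance from \<open>t\<close> to \<open>x\<close> is called \<open>y\<close>, because \<open>y = x - t\<close> is the point at which \<open>f\<close> is
  evaluated in the maximal function. Measurability of the section is included so that the integral
  defining the average is not the default value \<open>0\<close>.
\<close>
definition slow_phase :: "nat \<Rightarrow> (real \<Rightarrow> real \<Rightarrow> real) \<Rightarrow> bool" where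
  "slow_phase D \<gamma> \<longleftrightarrow>
     (\<exists>\<eta>>0. AE x in lebesgue. 0 < x \<and> x < \<eta> \<longrightarrow>
        \<gamma> x \<in> borel_measurable lebesgue \<and>
        (\<forall>y\<in>{0..x ^ D}. \<bar>\<gamma> x (x - y) - \<gamma> x x\<bar> \<le> 1 / 2))"

text \<open>
  Both \<open>x - y\<close> and \<open>x\<close> lie in \<open>[0, \<eta>)\<close>, where \<open>\<beta>\<close> is close to \<open>\<beta> 0\<close>.
\<close>
lemma slow_phase_product:
  assumes \<alpha>: "Linf \<alpha>" and \<beta>: "continuous_on UNIV \<beta>"
    and \<gamma>: "\<And>x t. \<gamma> x t = \<alpha> x * \<beta> t"
  shows "slow_phase 1 \<gamma>"
proof -
  obtain C where C: "AE x in lebesgue. \<bar>\<alpha> x\<bar> \<le> C" using \<alpha> by (auto simp: Linf_def)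
  define e where "e = 1 / (4 * (\<bar>C\<bar> + 1))"
  have e: "e > 0" "\<bar>C\<bar> * (2 * e) \<le> 1 / 2" by (auto simp: e_def field_simps add_pos_nonneg)
  have "isCont \<beta> 0" using \<beta> by (simp add: continuous_on_eq_continuous_at)
  then obtain \<eta> where \<eta>: "\<eta> > 0" "\<And>s. \<bar>s\<bar> < \<eta> \<Longrightarrow> \<bar>\<beta> s - \<beta> 0\<bar> < e"
    using e(1) unfolding continuous_at_eps_delta by (metis dist_real_def diff_zero)
  have m: "\<beta> \<in> borel_measurable lebesgue"
    using \<beta> by (intro measurable_completion) (simp add: borel_measurable_continuous_onI)
  show ?thesis unfolding slow_phase_def
  proof (intro exI[of _ \<eta>] conjI \<eta>(1))
    show "AE x in lebesgue. 0 < x \<and> x < \<eta> \<longrightarrow> \<gamma> x \<in> borel_measurable lebesgue \<and>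
        (\<forall>y\<in>{0..x ^ 1}. \<bar>\<gamma> x (x - y) - \<gamma> x x\<bar> \<le> 1 / 2)"
      using C
    proof eventually_elim
      case (elim x)
      show ?case
      proof (intro impI conjI ballI)
        have "\<gamma> x = (\<lambda>t. \<alpha> x * \<beta> t)" using \<gamma> by auto
        then show "\<gamma> x \<in> borel_measurable lebesgue" using m by simp
        fix y assume x: "0 < x \<and> x < \<eta>" and y: "y \<in> {0..x ^ 1}"
        have "\<bar>\<beta> (x - y) - \<beta> x\<bar> \<le> 2 * e"
          using \<eta>(2)[of x] \<eta>(2)[of "x - y"] x y by auto
        then have "\<bar>\<alpha> x\<bar> * \<bar>\<beta> (x - y) - \<beta> x\<bar> \<le> \<bar>C\<bar> * (2 * e)"
          using elim by (intro mult_mono) auto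
        then show "\<bar>\<gamma> x (x - y) - \<gamma> x x\<bar> \<le> 1 / 2"
          using e(2) unfolding \<gamma> by (simp add: abs_mult[symmetric] right_diff_distrib)
      qed
    qed
  qed
qed

text \<open>
  The worst exponent is \<open>- d\<close>, whose derivative has size \<open>d / z ^ (d + 1)\<close> with \<open>z \<ge> x / 2\<close>.
\<close>
lemma powi_increment:
  fixes x t :: real
  assumes "0 < x" "x \<le> 1" "x / 2 \<le> t" "t \<le> x" "\<bar>j\<bar> \<le> int d"
  shows "\<bar>t powi j - x powi j\<bar> \<le> real d * (2 / x) ^ (d + 1) * (x - t)"
proof (cases "t = x")
  case False
  then have tx: "t < x" using assms by simp
  have "\<exists>z. z > t \<and> z < x \<and> x powi j - t powi j = (x - t) * (of_int j * z powi (j - 1))"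
    using assms by (intro MVT2[OF tx]) (auto simp: has_field_derivative_def intro!: derivative_eq_intros)
  then obtain z where z: "t < z" "z < x" "x powi j - t powi j = (x - t) * (of_int j * z powi (j - 1))"
    by blast
  have z0: "0 < z" "z \<le> 1" using z assms by auto
  have "z powi (j - 1) \<le> z powi (- int (d + 1))"
    using assms z0 by (intro power_int_decreasing) auto
  also have "\<dots> = (1 / z) ^ (d + 1)" by (simp only: power_int_minus power_int_of_nat power_one_over) (simp add: divide_inverse)
  also have "\<dots> \<le> (2 / x) ^ (d + 1)"
    using z assms by (intro power_mono) (auto simp: field_simps)
  finally have zb: "z powi (j - 1) \<le> (2 / x) ^ (d + 1)" .
  have zp: "0 \<le> z powi (j - 1)" using z0 by simp
  have jd: "\<bar>real_of_int j\<bar> \<le> real d" using assms(5) by linarith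
  have "\<bar>t powi j - x powi j\<bar> = \<bar>(x - t) * (of_int j * z powi (j - 1))\<bar>" using z(3) by linarith
  also have "\<dots> = (x - t) * (\<bar>real_of_int j\<bar> * z powi (j - 1))"
    using tx zp by (simp add: abs_mult)
  also have "\<dots> \<le> (x - t) * (real d * (2 / x) ^ (d + 1))"
    using tx zp zb jd by (intro mult_left_mono mult_mono) auto
  finally show ?thesis by (simp add: mult_ac)
qed (use assms in auto)

text \<open>
  By the preceding lemma the phase moves by at most a constant times
  \<open>y / x ^ (d + 1)\<close>, which for \<open>y \<le> x ^ (d + 2)\<close> is a constant times \<open>x\<close> and hence small.
\<close>
lemma slow_phase_laurent:
  assumes d: "d > 0" and c: "\<And>j. j \<in> {- int d..int d} \<Longrightarrow> Linf (c j)"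
    and \<gamma>: "\<And>x t. t \<noteq> 0 \<Longrightarrow> \<gamma> x t = (\<Sum>j\<in>{- int d..int d}. c j x * t powi j)"
  shows "slow_phase (d + 2) \<gamma>"
proof -
  let ?J = "{- int d..int d}"
  have "\<forall>j\<in>?J. \<exists>C. AE x in lebesgue. \<bar>c j x\<bar> \<le> C" using c by (auto simp: Linf_def)
  then obtain C where C: "\<And>j. j \<in> ?J \<Longrightarrow> AE x in lebesgue. \<bar>c j x\<bar> \<le> C j" by metis
  define K where "K = (\<Sum>j\<in>?J. \<bar>C j\<bar>) * (real d * 2 ^ (d + 1))"
  have K: "K \<ge> 0" unfolding K_def by (intro mult_nonneg_nonneg sum_nonneg) auto
  define \<eta> where "\<eta> = 1 / (2 * (K + 1))"
  have \<eta>: "\<eta> > 0" "\<eta> \<le> 1 / 2" "K * \<eta> \<le> 1 / 2" using K by (auto simp: \<eta>_def field_simps)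
  have "AE x in lebesgue. \<forall>j\<in>?J. \<bar>c j x\<bar> \<le> C j"
    using C by (intro eventually_ball_finite) auto
  then have "AE x in lebesgue. 0 < x \<and> x < \<eta> \<longrightarrow> \<gamma> x \<in> borel_measurable lebesgue \<and>
        (\<forall>y\<in>{0..x ^ (d + 2)}. \<bar>\<gamma> x (x - y) - \<gamma> x x\<bar> \<le> 1 / 2)"
  proof eventually_elim
    case (elim x)
    show ?case
    proof (intro impI conjI ballI)
      have "\<gamma> x = (\<lambda>t. if t = 0 then \<gamma> x 0 else (\<Sum>j\<in>?J. c j x * t powi j))"
        using \<gamma> by auto
      moreover have "\<dots> \<in> borel_measurable borel" unfolding power_int_def by measurable
      ultimately show "\<gamma> x \<in> borel_measurable lebesgue"
        by (intro measurable_completion) simp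
      fix y assume x: "0 < x \<and> x < \<eta>" and y: "y \<in> {0..x ^ (d + 2)}"
      have x1: "0 < x" "x \<le> 1" "x \<le> 1 / 2" using x \<eta> by auto
      have "x ^ (d + 2) \<le> x ^ 2" using x1 by (intro power_decreasing) auto
      also have "\<dots> \<le> x / 2" using x1 mult_left_mono[of x "1/2" x] by (simp add: power2_eq_square)
      finally have y2: "0 \<le> y" "y \<le> x / 2" using y by auto
      have "\<bar>\<gamma> x (x - y) - \<gamma> x x\<bar> = \<bar>\<Sum>j\<in>?J. c j x * ((x - y) powi j - x powi j)\<bar>"
        using x1 y2 by (subst (1 2) \<gamma>) (auto simp: sum_subtractf right_diff_distrib)
      also have "\<dots> \<le> (\<Sum>j\<in>?J. \<bar>c j x * ((x - y) powi j - x powi j)\<bar>)" by (rule sum_abs)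
      also have "\<dots> \<le> (\<Sum>j\<in>?J. \<bar>C j\<bar> * (real d * (2 / x) ^ (d + 1) * y))"
      proof (rule sum_mono)
        fix j assume j: "j \<in> ?J"
        then have "\<bar>c j x\<bar> \<le> \<bar>C j\<bar>" using elim by fastforce
        moreover have "\<bar>(x - y) powi j - x powi j\<bar> \<le> real d * (2 / x) ^ (d + 1) * y"
          using powi_increment[of x "x - y" j d] x1 y2 j by auto
        ultimately show "\<bar>c j x * ((x - y) powi j - x powi j)\<bar>
            \<le> \<bar>C j\<bar> * (real d * (2 / x) ^ (d + 1) * y)"
          unfolding abs_mult by (rule mult_mono) auto
      qed
      also have "\<dots> = (\<Sum>j\<in>?J. \<bar>C j\<bar>) * (real d * (2 / x) ^ (d + 1) * y)"
        by (rule sum_distrib_right[symmetric])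
      also have "\<dots> \<le> (\<Sum>j\<in>?J. \<bar>C j\<bar>) * (real d * (2 / x) ^ (d + 1) * x ^ (d + 2))"
        using y x1 by (intro mult_left_mono sum_nonneg) auto
      also have "\<dots> = K * x" using x1 unfolding K_def by (simp add: power_divide)
      also have "\<dots> \<le> K * \<eta>" using x K by (intro mult_left_mono) auto
      also note \<eta>(3)
      finally show "\<bar>\<gamma> x (x - y) - \<gamma> x x\<bar> \<le> 1 / 2" .
    qed
  qed
  with \<eta>(1) show ?thesis unfolding slow_phase_def by blast
qed

section \<open>Lower bounds for the oscillatory maximal function\<close>

lemma cos_ge_half: 
  fixes u :: real assumes "\<bar>u\<bar> \<le> 1 / 2"
  shows "cos u \<ge> 1 / 2"
proof -
  have "cos (pi / 3) \<le> cos \<bar>u\<bar>" using assms pi_ge_two by (intro cos_monotone_0_pi_le) auto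
  then show ?thesis by (simp add: cos_60)
qed

text \<open>
  The radius \<open>r = x\<close> makes \<open>x - t\<close> run through \<open>[0, 2 x]\<close> only, which avoids the negative part of an
  odd \<open>F\<close>. After rotation by the phase at \<open>y = 0\<close>, the real part of the integrand is
  \<open>F y\<close> times a cosine. The cosine is at least \<open>1 / 2\<close> on \<open>(0, \<delta>]\<close>, where \<open>F\<close> has mass at
  least \<open>A \<delta>\<close>. On the rest it can be as small as \<open>-1\<close>, but there \<open>F \<le> B\<close>, which costs at
  most \<open>2 x B\<close>.
\<close>
lemma osc_maximal_lower_bound:
  fixes F :: "real \<Rightarrow> real"
  assumes F: "integrable lborel F" and x: "x > 0" and m: "\<gamma> x \<in> borel_measurable lebesgue"
    and \<delta>: "0 \<le> \<delta>" "\<delta> \<le> 2 * x"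
    and slow: "\<And>y. 0 \<le> y \<Longrightarrow> y \<le> \<delta> \<Longrightarrow> \<bar>\<gamma> x (x - y) - \<gamma> x x\<bar> \<le> 1 / 2"
    and A: "0 \<le> A" "\<And>y. 0 < y \<Longrightarrow> y \<le> \<delta> \<Longrightarrow> A \<le> F y"
    and B: "0 \<le> B" "\<And>y. \<delta> < y \<Longrightarrow> 0 \<le> F y \<and> F y \<le> B" and F0: "F 0 = 0"
  shows "ennreal (1 / (2 * x) * (A * \<delta> / 2 - 2 * x * B))
           \<le> osc_maximal \<gamma> (\<lambda>y. complex_of_real (F y)) x"
proof -
  define h where "h t = complex_of_real (F (x - t)) * exp (\<i> * complex_of_real (\<gamma> x t))" for t
  define I where "I = (LINT t:{-x..x}|lebesgue. h t)"
  define u where "u = exp (\<i> * complex_of_real (- \<gamma> x x))"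
  note [measurable] = m
  have FR: "integrable lebesgue (\<lambda>t. F (x - t))"
    using F lborel_integrable_real_affine_iff[of "-1" F x] by (simp add: integrable_completion)
  then have [measurable]: "(\<lambda>t. F (x - t)) \<in> borel_measurable lebesgue" by simp
  have hm: "h \<in> borel_measurable lebesgue"
    unfolding h_def by measurable
  have hi: "integrable lebesgue (\<lambda>t. indicator {-x..x} t *\<^sub>R h t)"
  proof (rule Bochner_Integration.integrable_bound[OF FR])
    show "(\<lambda>t. indicator {-x..x} t *\<^sub>R h t) \<in> borel_measurable lebesgue"
      using hm by (intro borel_measurable_scaleR borel_measurable_indicator) auto
    show "AE t in lebesgue. norm (indicator {-x..x} t *\<^sub>R h t) \<le> norm (F (x - t))"
      by (auto simp: h_def norm_mult indicator_def)
  qed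
  define g where "g t = indicator {-x..x} t * (F (x - t) * cos (\<gamma> x t - \<gamma> x x))" for t
  have Re_g: "Re (u * (indicator {-x..x} t *\<^sub>R h t)) = g t" for t
  proof -
    have "u * h t = complex_of_real (F (x - t)) * exp (\<i> * complex_of_real (\<gamma> x t - \<gamma> x x))"
      unfolding u_def h_def by (simp add: exp_add[symmetric] algebra_simps exp_diff exp_minus divide_inverse)
    then show ?thesis by (simp add: g_def Re_exp cos_diff indicator_def)
  qed
  have ui: "integrable lebesgue (\<lambda>t. u * (indicator {-x..x} t *\<^sub>R h t))"
    by (rule integrable_mult_right[OF hi])
  have gi: "integrable lebesgue g"
    using integrable_Re[OF ui] unfolding Re_g .
  have "(\<integral>t. g t \<partial>lebesgue) = Re (\<integral>t. u * (indicator {-x..x} t *\<^sub>R h t) \<partial>lebesgue)"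
    using integral_Re[OF ui] unfolding Re_g .
  also have "\<dots> = Re (u * I)"
    unfolding I_def set_lebesgue_integral_def by (simp only: integral_mult_right_zero)
  also have "\<dots> \<le> cmod (u * I)" by (rule complex_Re_le_cmod)
  also have "\<dots> = cmod I" by (simp add: norm_mult u_def)
  finally have gI: "(\<integral>t. g t \<partial>lebesgue) \<le> cmod I" .
  \<comment> \<open>The minorant of \<open>g\<close>: the slow part \<open>(0, \<delta>]\<close> of the variable \<open>x - t\<close> is \<open>[x - \<delta>, x)\<close> in \<open>t\<close>.\<close>
  define l where "l t = A / 2 * indicator {x - \<delta>..<x} t - B * indicator {-x..x} t" for t
  have [measurable]: "l \<in> borel_measurable borel" unfolding l_def by measurable
  have li: "integrable lborel l" unfolding l_def
    using x \<delta> by (intro Bochner_Integration.integrable_diff) (auto simp: integrable_indicator_iff)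
  have "A * \<delta> / 2 - 2 * x * B = (\<integral>t. l t \<partial>lborel)"
    unfolding l_def using x \<delta>
    by (subst Bochner_Integration.integral_diff) (auto simp: integrable_indicator_iff)
  also have "\<dots> = (\<integral>t. l t \<partial>lebesgue)" by (rule integral_completion[symmetric]) measurable
  also have "\<dots> \<le> (\<integral>t. g t \<partial>lebesgue)"
  proof (rule integral_mono)
    show "integrable lebesgue l" using li by (simp add: integrable_completion)
    fix t
    show "l t \<le> g t"
    proof (cases "t \<in> {-x..x}")
      case False
      then have "t \<notin> {x - \<delta>..<x}" using \<delta> by auto
      with False show ?thesis by (simp add: l_def g_def)
    next
      case True
      consider "t = x" | "x - \<delta> \<le> t" "t < x" | "t < x - \<delta>" using True by fastforce
      then show ?thesis
      proof cases
        case 1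
        then show ?thesis using F0 B(1) x by (simp add: l_def g_def)
      next
        case 2
        have "1 / 2 \<le> cos (\<gamma> x t - \<gamma> x x)"
          using slow[of "x - t"] 2 by (intro cos_ge_half) auto
        moreover have "A \<le> F (x - t)" using 2 by (intro A) auto
        ultimately have "A * (1 / 2) \<le> F (x - t) * cos (\<gamma> x t - \<gamma> x x)"
          using A(1) by (intro mult_mono) auto
        then show ?thesis using True 2 B(1) by (simp add: l_def g_def)
      next
        case 3
        have F: "0 \<le> F (x - t)" "F (x - t) \<le> B" using B(2)[of "x - t"] 3 by auto
        then have "F (x - t) * (- 1) \<le> F (x - t) * cos (\<gamma> x t - \<gamma> x x)"
          by (intro mult_left_mono) auto
        then show ?thesis using True 3 F by (simp add: l_def g_def)
      qed
    qed
  qed (rule gi)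
  also note gI
  finally have "1 / (2 * x) * (A * \<delta> / 2 - 2 * x * B) \<le> 1 / (2 * x) * cmod I"
    using x by (intro mult_left_mono) auto
  then have "ennreal (1 / (2 * x) * (A * \<delta> / 2 - 2 * x * B)) \<le> ennreal (1 / (2 * x) * cmod I)"
    by (rule ennreal_leI)
  also have "\<dots> \<le> osc_maximal \<gamma> (\<lambda>y. complex_of_real (F y)) x"
    unfolding osc_maximal_def I_def h_def using x by (intro SUP_upper) auto
  finally show ?thesis .
qed

lemma dipole_series_at_0: "dipole_series w \<delta> 0 = 0"
  by (simp add: dipole_series_def dipole_def)

lemma dipole_nonneg: "0 \<le> \<delta> \<Longrightarrow> 0 \<le> y \<Longrightarrow> 0 \<le> dipole \<delta> y"
  by (auto simp: dipole_def indicator_def)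

lemma dipole_series_ge_term:
  assumes \<delta>: "\<delta> \<longlonglongrightarrow> 0" "\<And>j. \<delta> j > 0" and w: "\<And>j. w j \<ge> 0" and y: "0 < y" "y \<le> \<delta> k"
  shows "w k / \<delta> k \<le> dipole_series w \<delta> y"
proof -
  have "w k / \<delta> k = (\<Sum>j\<in>{k}. w j * dipole (\<delta> j) y)" using y by (simp add: dipole_def)
  also have "\<dots> \<le> dipole_series w \<delta> y" unfolding dipole_series_def
    using summable_norm_cancel[OF dipole_series_summable[OF \<delta>(1), of w y]] \<delta>(2) w y
    by (intro sum_le_suminf) (auto intro!: mult_nonneg_nonneg dipole_nonneg simp: less_imp_le)
  finally show ?thesis .
qed

text \<open>
  To the right of \<open>\<delta> (Suc k)\<close> only the dipoles up to index \<open>k\<close> survive, and the finest of these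
  has height \<open>1 / \<delta> k\<close>.
\<close>
lemma dipole_series_tail_bound:
  assumes \<delta>: "\<delta> \<longlonglongrightarrow> 0" "\<And>j. \<delta> j > 0" "decseq \<delta>" and w: "\<And>j. w j \<ge> 0" "summable w"
    and y: "\<delta> (Suc k) < y"
  shows "0 \<le> dipole_series w \<delta> y" "dipole_series w \<delta> y \<le> suminf w / \<delta> k"
proof -
  note s = summable_norm_cancel[OF dipole_series_summable[OF \<delta>(1), of w y]]
  have y0: "0 < y" using y \<delta>(2)[of "Suc k"] by simp
  show "0 \<le> dipole_series w \<delta> y" unfolding dipole_series_def
    using s \<delta>(2) w y0 by (intro suminf_nonneg) (auto intro!: mult_nonneg_nonneg dipole_nonneg simp: less_imp_le)
  have "dipole_series w \<delta> y \<le> (\<Sum>j. w j / \<delta> k)" unfolding dipole_series_def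
  proof (rule suminf_le[OF _ s summable_divide[OF w(2)]])
    fix j
    show "w j * dipole (\<delta> j) y \<le> w j / \<delta> k"
    proof (cases "j \<le> k")
      case True
      have "dipole (\<delta> j) y \<le> 1 / \<delta> j" using dipole_bound[OF \<delta>(2), of j y] by linarith
      also have "\<dots> \<le> 1 / \<delta> k"
        using decseqD[OF \<delta>(3) True] \<delta>(2)[of k] by (intro divide_left_mono) (auto simp: \<delta>(2))
      finally have "w j * dipole (\<delta> j) y \<le> w j * (1 / \<delta> k)" using w(1) by (rule mult_left_mono)
      then show ?thesis by simp
    next
      case False
      then have "\<delta> j \<le> \<delta> (Suc k)" using \<delta>(3) by (simp add: decseq_def)
      then have "dipole (\<delta> j) y = 0" using y y0 by (intro dipole_support) auto
      then show ?thesis using w(1)[of j] \<delta>(2)[of k] by simp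
    qed
  qed
  also have "\<dots> = suminf w / \<delta> k" using w(2) by (rule suminf_divide)
  finally show "dipole_series w \<delta> y \<le> suminf w / \<delta> k" .
qed

section \<open>Non-integrability for slow phases\<close>

text \<open>
  The \<open>D\<close>-th root of the scale is \<open>(1 / 2) ^ ((D + 9) ^ k)\<close>. On the logarithmic scale it must be
  separated from the preceding scale \<open>(1 / 2) ^ (D * (D + 9) ^ (k - 1))\<close> by an amount
  that outgrows \<open>2 ^ k\<close>. A base exceeding \<open>D\<close> by \<open>9\<close> gives a separation of \<open>9 * (D + 9) ^ (k - 1)\<close>, which
  leaves \<open>4 ^ k\<close> after the linear losses are subtracted.
\<close>
definition dipole_scale :: "nat \<Rightarrow> nat \<Rightarrow> real" where
  "dipole_scale D k = (1 / 2) ^ (D * (D + 9) ^ k)"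

lemma dipole_scale_pos: "0 < dipole_scale D k"
  by (simp add: dipole_scale_def)

lemma dipole_scale_decseq: "decseq (dipole_scale D)"
  unfolding decseq_Suc_iff dipole_scale_def by (intro allI power_decreasing) auto

lemma dipole_scale_tendsto_0:
  assumes "D > 0"
  shows "dipole_scale D \<longlonglongrightarrow> 0"
proof (rule tendsto_sandwich[where f = "\<lambda>_. 0" and h = "\<lambda>k. (1 / 2) ^ k"])
  show "\<forall>\<^sub>F k in sequentially. dipole_scale D k \<le> (1 / 2) ^ k"
  proof (intro always_eventually allI)
    fix k
    have "k < 2 ^ k" by (rule less_exp)
    also have "\<dots> \<le> (D + 9) ^ k" by (intro power_mono) auto
    also have "\<dots> \<le> D * (D + 9) ^ k" using assms by simp
    finally show "dipole_scale D k \<le> (1 / 2) ^ k" unfolding dipole_scale_def by (intro power_decreasing) auto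
  qed
qed (auto simp: dipole_scale_pos less_imp_le LIMSEQ_realpow_zero)

lemma nn_integral_inverse:
  fixes a b c :: real
  assumes "0 < a" "a \<le> b" "0 \<le> c"
  shows "(\<integral>\<^sup>+x. ennreal (c / x) * indicator {a..b} x \<partial>lborel) = ennreal (c * ln (b / a))"
proof -
  have "(\<integral>\<^sup>+x. ennreal (c / x) * indicator {a..b} x \<partial>lborel) = ennreal (c * ln b - c * ln a)"
    using assms by (intro nn_integral_FTC_Icc) (auto intro!: derivative_eq_intros)
  then show ?thesis using assms by (simp add: ln_div right_diff_distrib)
qed

text \<open>
  A single interval \<open>[a, b]\<close> for each index \<open>j\<close> carries enough mass. Its left end \<open>a\<close> is the
  \<open>D\<close>-th root of the scale with index \<open>Suc j\<close>, so the phase is slow on the positive half of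
  that dipole. Its right end \<open>b\<close> is so small compared with the scale of index \<open>j\<close> that the
  coarser dipoles cost at most half of what the dipole of index \<open>Suc j\<close> contributes. On the
  interval the maximal function is at least \<open>(1 / 2) ^ (j + 4) / x\<close>, and \<open>ln (b / a) \<ge> 4 ^ Suc j * ln 2\<close>.
\<close>
lemma slow_phase_not_L1:
  assumes D: "D > 0" and slow: "slow_phase D \<gamma>"
  shows "\<not> L1_ennreal (osc_maximal \<gamma>
           (\<lambda>y. complex_of_real (dipole_series (\<lambda>k. (1 / 2) ^ k) (dipole_scale D) y)))"
proof
  let ?w = "\<lambda>k. (1 / 2 :: real) ^ k"
  let ?F = "dipole_series ?w (dipole_scale D)"
  let ?M = "osc_maximal \<gamma> (\<lambda>y. complex_of_real (?F y))"
  assume "L1_ennreal ?M"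
  then have fin: "(\<integral>\<^sup>+ x. ?M x \<partial>lebesgue) < \<infinity>" by (simp add: L1_ennreal_def)
  obtain \<eta> where \<eta>: "\<eta> > 0" and ae: "AE x in lebesgue. 0 < x \<and> x < \<eta> \<longrightarrow>
        \<gamma> x \<in> borel_measurable lebesgue \<and>
        (\<forall>y\<in>{0..x ^ D}. \<bar>\<gamma> x (x - y) - \<gamma> x x\<bar> \<le> 1 / 2)"
    using slow unfolding slow_phase_def by blast
  obtain J where J: "?w J < \<eta>" using real_arch_pow_inv[OF \<eta>, of "1 / 2"] by auto
  have w: "\<And>k. 0 \<le> ?w k" "summable ?w" "suminf ?w = 2"
    by (auto simp: suminf_geometric)
  note \<delta> = dipole_scale_tendsto_0[OF D] dipole_scale_pos dipole_scale_decseq[of D]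
  have F: "integrable lborel ?F"
    using integrable_Re[OF dipole_series_integral(2)[OF \<delta>(1,2) w(1,2), of "\<lambda>_. 1" 1]] by simp
  have large: "ennreal (ln 2 / 4 * 2 ^ j) \<le> (\<integral>\<^sup>+ x. ?M x \<partial>lebesgue)" if "j \<ge> J" for j
  proof -
    define a :: real where "a = (1 / 2) ^ ((D + 9) ^ Suc j)"
    define b where "b = (1 / 2) ^ (j + 5) * dipole_scale D j"
    have ap: "0 < a" "a ^ D = dipole_scale D (Suc j)"
      by (simp_all add: a_def dipole_scale_def power_mult[symmetric] mult_ac)
    define N where "N = (D + 9) ^ Suc j - (j + 5 + D * (D + 9) ^ j)"
    have exps: "4 ^ Suc j + (j + 5 + D * (D + 9) ^ j) \<le> (D + 9) ^ Suc j"
    proof -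
      have "4 ^ j \<le> (D + 9) ^ j" by (intro power_mono) auto
      moreover have "j + 5 \<le> 5 * 4 ^ j" by (induction j) auto
      ultimately show ?thesis by (simp add: algebra_simps)
    qed
    have ba: "b / a = 2 ^ N" and N: "4 ^ Suc j \<le> N"
    proof -
      have "(D + 9) ^ Suc j = N + (j + 5 + D * (D + 9) ^ j)" using exps by (simp add: N_def)
      then have "a = (1 / 2) ^ N * b" by (simp add: a_def b_def dipole_scale_def power_add)
      then show "b / a = 2 ^ N" using ap(1) by (simp add: field_simps power_one_over)
      show "4 ^ Suc j \<le> N" using exps by (simp add: N_def)
    qed
    have ab: "a \<le> b" using ba ap(1) by (metis one_le_power one_le_numeral pos_le_divide_eq mult_1)
    have b\<eta>: "b < \<eta>"
    proof -
      have "b \<le> ?w (j + 5) * 1" unfolding b_def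
        by (intro mult_left_mono) (auto simp: dipole_scale_def power_le_one)
      also have "\<dots> \<le> ?w J" using that by (simp add: power_decreasing)
      finally show ?thesis using J by simp
    qed
    have pt: "ennreal ((1 / 2) ^ (j + 4) / x) \<le> ?M x"
      if x: "a \<le> x" "x \<le> b" and m: "\<gamma> x \<in> borel_measurable lebesgue"
        and s: "\<forall>y\<in>{0..x ^ D}. \<bar>\<gamma> x (x - y) - \<gamma> x x\<bar> \<le> 1 / 2" for x
    proof -
      have x0: "0 < x" using x ap by linarith
      have x1: "x \<le> 1"
      proof -
        have "b \<le> 1" unfolding b_def by (intro mult_le_one) (auto simp: dipole_scale_def power_le_one)
        then show ?thesis using x by simp
      qed
      have dx: "dipole_scale D (Suc j) \<le> x ^ D"
        using x ap by (metis less_imp_le power_mono)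
      have "x ^ D \<le> x ^ 1" using x0 x1 D by (intro power_decreasing) auto
      then have dx2: "dipole_scale D (Suc j) \<le> 2 * x" using dx x0 by simp
      have "ennreal (1 / (2 * x) * (?w (Suc j) / dipole_scale D (Suc j) * dipole_scale D (Suc j) / 2
          - 2 * x * (2 / dipole_scale D j))) \<le> ?M x"
      proof (rule osc_maximal_lower_bound[where F = ?F and \<gamma> = \<gamma> and x = x and \<delta> = "dipole_scale D (Suc j)", OF F x0 m])
        show "\<bar>\<gamma> x (x - y) - \<gamma> x x\<bar> \<le> 1 / 2" if "0 \<le> y" "y \<le> dipole_scale D (Suc j)" for y
          using s that dx by auto
        show "?w (Suc j) / dipole_scale D (Suc j) \<le> ?F y" if "0 < y" "y \<le> dipole_scale D (Suc j)" for y
          using dipole_series_ge_term[OF \<delta>(1,2) w(1) that] .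
        show "0 \<le> ?F y \<and> ?F y \<le> 2 / dipole_scale D j" if "dipole_scale D (Suc j) < y" for y
          using dipole_series_tail_bound[OF \<delta> w(1,2) that] w(3) by simp
      qed (use dipole_scale_pos[of D] dx2 in \<open>auto simp: less_imp_le dipole_series_at_0\<close>)
      moreover have "(1 / 2) ^ (j + 4) / x \<le> 1 / (2 * x) * (?w (Suc j) / dipole_scale D (Suc j) * dipole_scale D (Suc j) / 2
          - 2 * x * (2 / dipole_scale D j))"
      proof -
        have "x / dipole_scale D j \<le> (1 / 2) ^ (j + 5)"
          using x(2) dipole_scale_pos[of D j] by (simp add: b_def pos_divide_le_eq)
        moreover have "?w (j + 5) = ?w j / 32" "?w (j + 3) = ?w j / 8" "?w (Suc j) / 2 = ?w j / 4"
          by (simp_all add: power_add power_one_over)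
        ultimately have "?w (j + 3) \<le> ?w (Suc j) / 2 - 4 * (x / dipole_scale D j)"
          by linarith
        then have "1 / (2 * x) * ?w (j + 3) \<le> 1 / (2 * x) * (?w (Suc j) / 2 - 4 * (x / dipole_scale D j))"
          using x0 by (intro mult_left_mono) auto
        moreover have "(1 / 2) ^ (j + 4) / x = 1 / (2 * x) * ?w (j + 3)"
          using x0 by (simp add: power_add power_one_over)
        moreover have "?w (Suc j) / dipole_scale D (Suc j) * dipole_scale D (Suc j) / 2
            - 2 * x * (2 / dipole_scale D j) = ?w (Suc j) / 2 - 4 * (x / dipole_scale D j)"
          using dipole_scale_pos[of D "Suc j"] by simp
        ultimately show ?thesis by (simp only:)
      qed
      ultimately show ?thesis using ennreal_leI order_trans by blast
    qed
    have "ln 2 / 4 * 2 ^ j = (1 / 2 :: real) ^ (j + 4) * (ln 2 * 4 ^ Suc j)"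
    proof -
      have "(4 :: real) ^ j = 2 ^ j * 2 ^ j" by (simp add: power_mult_distrib[symmetric])
      then show ?thesis by (simp add: power_add power_one_over)
    qed
    also have "\<dots> \<le> (1 / 2) ^ (j + 4) * ln (b / a)"
    proof -
      have "real (4 ^ Suc j) \<le> real N" using N by (simp only: of_nat_le_iff)
      then show ?thesis unfolding ba by (simp add: ln_realpow)
    qed
    finally have "ennreal (ln 2 / 4 * 2 ^ j) \<le> ennreal ((1 / 2) ^ (j + 4) * ln (b / a))"
      by (rule ennreal_leI)
    also have "\<dots> = (\<integral>\<^sup>+x. ennreal ((1 / 2) ^ (j + 4) / x) * indicator {a..b} x \<partial>lebesgue)"
      unfolding nn_integral_completion using nn_integral_inverse[OF ap(1) ab, of "(1 / 2) ^ (j + 4)"] by simp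
    also have "\<dots> \<le> (\<integral>\<^sup>+ x. ?M x \<partial>lebesgue)"
    proof (rule nn_integral_mono_AE)
      show "AE x in lebesgue. ennreal ((1 / 2) ^ (j + 4) / x) * indicator {a..b} x \<le> ?M x"
        using ae
      proof eventually_elim
        case (elim x)
        show ?case
        proof (cases "x \<in> {a..b}")
          case True
          then show ?thesis using elim pt[of x] ap(1) b\<eta> by auto
        qed simp
      qed
    qed
    finally show ?thesis .
  qed
  obtain r where r: "0 \<le> r" "(\<integral>\<^sup>+ x. ?M x \<partial>lebesgue) = ennreal r"
    using fin by (cases "\<integral>\<^sup>+ x. ?M x \<partial>lebesgue") auto
  obtain n where n: "r * 4 / ln 2 < 2 ^ n" using real_arch_pow[of 2] by auto
  have "(2 :: real) ^ n \<le> 2 ^ max n J" by (intro power_increasing) auto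
  then have "r * 4 / ln 2 < 2 ^ max n J" using n by linarith
  then have "r < ln 2 / 4 * 2 ^ max n J" by (simp add: field_simps)
  moreover have "ln 2 / 4 * 2 ^ max n J \<le> r"
    using large[of "max n J"] r by (simp add: ennreal_le_iff)
  ultimately show False by simp
qed

theorem theorem1p1:
  fixes \<gamma> :: "real \<Rightarrow> real \<Rightarrow> real" and \<phi> :: "real \<Rightarrow> complex"
  assumes "schwartz \<phi>" and "(LINT x|lebesgue. \<phi> x) \<noteq> 0"
    and "(\<lambda>(x, t). \<gamma> x t) \<in> borel_measurable (lebesgue :: (real \<times> real) measure)"
    and "(\<exists>\<alpha> \<beta> :: real \<Rightarrow> real.
            Linf \<alpha> \<and> \<beta> \<in> borel_measurable lebesgue \<and> continuous_on UNIV \<beta> \<and>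
            (\<forall>x t. \<gamma> x t = \<alpha> x * \<beta> t)) \<or>
         (\<exists>(d :: nat) (c :: int \<Rightarrow> real \<Rightarrow> real).
            d > 0 \<and> (\<forall>j\<in>{- int d..int d}. Linf (c j)) \<and>
            (\<forall>x t. t \<noteq> 0 \<longrightarrow> \<gamma> x t = (\<Sum>j\<in>{- int d..int d}. c j x * t powi j)))"
  shows "\<exists>f \<in> hardy_H1 \<phi>. \<not> L1_ennreal (osc_maximal \<gamma> f)"
proof -
  obtain D where D: "D > 0" "slow_phase D \<gamma>"
    using assms(4)
  proof (elim disjE exE conjE)
    fix \<alpha> \<beta> :: "real \<Rightarrow> real"
    assume "Linf \<alpha>" "continuous_on UNIV \<beta>" "\<forall>x t. \<gamma> x t = \<alpha> x * \<beta> t"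
    then show thesis using that[of 1] slow_phase_product by auto
  next
    fix d :: nat and c :: "int \<Rightarrow> real \<Rightarrow> real"
    assume "d > 0" "\<forall>j\<in>{- int d..int d}. Linf (c j)"
      "\<forall>x t. t \<noteq> 0 \<longrightarrow> \<gamma> x t = (\<Sum>j\<in>{- int d..int d}. c j x * t powi j)"
    then show thesis using that[of "d + 2"] slow_phase_laurent[of d c \<gamma>] by auto
  qed
  have "(\<lambda>y. complex_of_real (dipole_series (\<lambda>k. (1 / 2) ^ k) (dipole_scale D) y)) \<in> hardy_H1 \<phi>"
    by (rule dipole_series_in_hardy_H1[OF assms(1) dipole_scale_tendsto_0[OF D(1)] dipole_scale_pos]) auto
  with slow_phase_not_L1[OF D] show ?thesis by blast
qed

end
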